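(* Let $(f_F,f_L)$ be a solution of the controlled leader-follower Boltzmann system in absence of diffusion and with $P\equiv S\equiv R\equiv 1$, as described in the context. Let $$E_F(t)=\int_I w^2f_F(w,t)\,dw,\qquad E_L(t)=\frac1\rho\int_I\tilde w^2f_L(\tilde w,t)\,d\tilde w .$$ Since the mean opinions satisfy $m_F(t),m_L(t)\to w_d$ as $t\to\infty$, it follows that $E_F(t)$ and $E_L(t)$ converge towards $w_d^2$. Then the quantities $$\int_I f_F(w,t)(w-w_d)^2\,dw=E_F(t)+w_d^2-2m_F(t)w_d,\qquad \frac1\rho\int_I f_L(\tilde w,t)(\tilde w-w_d)^2\,d\tilde w=E_L(t)+w_d^2-2m_L(t)w_d$$ go to zero as $t\to\infty$; that is, the steady state solutions have the form of a Dirac delta centered in the target opinion $w_d$.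
   Context: Let $I=[-1,1]$. The parameters are: $\alpha>0$, $\nu>0$, $\beta=\frac{4\alpha^2}{\nu+4\alpha^2}$, constant relaxation rates $\eta_F,\eta_{FL},\eta_L>0$, leader mass $\rho\in(0,1]$, target opinion $w_d\in I$, and nonnegative weights $\psi,\mu$ with $\psi+\mu=1$. The functions $P$, $S$, $R$ are the compromise functions weighting the follower-follower, leader-follower and leader-leader interactions respectively; here all are identically $1$. For each $t\ge0$, $f_F(\cdot,t)$ (followers) and $f_L(\cdot,t)$ (leaders) are densities (possibly measures) on $I$ with total masses $\int_I f_F(w,t)\,dw=1$ and $\int_I f_L(\tilde w,t)\,d\tilde w=\rho$. The mean opinions are $m_F(t)=\int_I w f_F(w,t)\,dw$ and $m_L(t)=\frac1\rho\int_I\tilde w f_L(\tilde w,t)\,d\tilde w$. Binary interactions (no noise, all compromise functions equal to $1$): (i) follower-follower: $w^*=w+\alpha(v-w)$, $v^*=v+\alpha(w-v)$; (ii) leader-follower: $w^{**}=w+\alpha(\tilde v-w)$, with the leader's opinion $\tilde v$ unchanged; (iii) leader-leader: $\tilde w^*=\tilde w+\alpha(\tilde v-\tilde w)+2\alpha u$, $\tilde v^*=\tilde v+\alpha(\tilde w-\tilde v)+2\alpha u$, with the feedback control $$2\alpha u=-\frac\beta2\Big[\psi\big((\tilde w-w_d)+(\tilde v-w_d)\big)+\mu\big((\tilde w-m_F)+(\tilde v-m_F)\big)\Big].$$ It is assumed that the interaction parameters are such that all post-interaction opinions lie in $I$. A solution of the Boltzmann system is a pair $(f_F,f_L)$ such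 that, for suitable test functions $\varphi$, $$\frac{d}{dt}\int_I\varphi(w)f_F(w,t)dw=\eta_F\int_{I^2}(\varphi(w^* )-\varphi(w))f_F(w,t)f_F(v,t)\,dw\,dv+\eta_{FL}\int_{I^2}(\varphi(w^{**})-\varphi(w))f_F(w,t)f_L(\tilde v,t)\,dw\,d\tilde v,$$ $$\frac{d}{dt}\int_I\varphi(\tilde w)f_L(\tilde w,t)d\tilde w=\eta_L\int_{I^2}(\varphi(\tilde w^* )-\varphi(\tilde w))f_L(\tilde w,t)f_L(\tilde v,t)\,d\tilde w\,d\tilde v.$$
   Formalization: Convergence of the mean opinions to w_d is proved for ψ>0; for ψ=0 it can fail (both populations concentrated at one point other than w_d), so there the limits and the Dirac form are stated for solutions whose means converge to w_d. *)

theory Defs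
  imports "HOL-Probability.Probability"
begin

definition opinions :: "real set" where
  "opinions = {-1..1}"

definition opinion_space :: "real measure" where
  "opinion_space = restrict_space borel opinions"

(* Opinion distributions are finite Borel measures on I, so that both densities and singular
   (e.g. Dirac) solutions are covered. *)
definition opinion_distribution :: "real \<Rightarrow> real measure \<Rightarrow> bool" where
  "opinion_distribution m f \<longleftrightarrow>
     sets f = sets opinion_space \<and> emeasure f (space f) = ennreal m"

definition mean_F :: "real measure \<Rightarrow> real" where
  "mean_F f = (LINT w|f. w)"

definition mean_L :: "real \<Rightarrow> real measure \<Rightarrow> real" where
  "mean_L \<rho> f = 1 / \<rho> * (LINT w|f. w)"

definition energy_F :: "real measure \<Rightarrow> real" where
  "energy_F f = (LINT w|f. w\<^sup>2)"

definition energy_L :: "real \<Rightarrow> real measure \<Rightarrow> real" where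
  "energy_L \<rho> f = 1 / \<rho> * (LINT w|f. w\<^sup>2)"

(* Each post-interaction map gives the new opinion of its first opinion argument; the new opinion
   of the partner in a symmetric interaction is obtained by exchanging the two. *)

definition post_FF :: "real \<Rightarrow> real \<Rightarrow> real \<Rightarrow> real" where
  "post_FF \<alpha> w v = w + \<alpha> * (v - w)"

definition post_LF :: "real \<Rightarrow> real \<Rightarrow> real \<Rightarrow> real" where
  "post_LF \<alpha> w v = w + \<alpha> * (v - w)"

definition control_beta :: "real \<Rightarrow> real \<Rightarrow> real" where
  "control_beta \<alpha> \<nu> = 4 * \<alpha>\<^sup>2 / (\<nu> + 4 * \<alpha>\<^sup>2)"

(* The value is the term 2 * alpha * u, not the control u itself. *)
definition feedback :: "real \<Rightarrow> real \<Rightarrow> real \<Rightarrow> real \<Rightarrow> real \<Rightarrow> real \<Rightarrow> real \<Rightarrow> real \<Rightarrow> real" where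
  "feedback \<alpha> \<nu> \<psi> \<mu> w\<^sub>d m w v =
     - (control_beta \<alpha> \<nu> / 2) *
       (\<psi> * ((w - w\<^sub>d) + (v - w\<^sub>d)) + \<mu> * ((w - m) + (v - m)))"

definition post_LL :: "real \<Rightarrow> real \<Rightarrow> real \<Rightarrow> real \<Rightarrow> real \<Rightarrow> real \<Rightarrow> real \<Rightarrow> real \<Rightarrow> real" where
  "post_LL \<alpha> \<nu> \<psi> \<mu> w\<^sub>d m w v = w + \<alpha> * (v - w) + feedback \<alpha> \<nu> \<psi> \<mu> w\<^sub>d m w v"

definition smooth :: "(real \<Rightarrow> real) \<Rightarrow> bool" where
  "smooth \<phi> \<longleftrightarrow> (\<forall>n x. (deriv ^^ n) \<phi> differentiable at x)"

(* Weak form against smooth test functions; the derivative at t = 0 is one-sided. *)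
definition boltzmann_solution ::
  "real \<Rightarrow> real \<Rightarrow> real \<Rightarrow> real \<Rightarrow> real \<Rightarrow> real \<Rightarrow> real \<Rightarrow> real \<Rightarrow> real \<Rightarrow>
   (real \<Rightarrow> real measure) \<Rightarrow> (real \<Rightarrow> real measure) \<Rightarrow> bool" where
  "boltzmann_solution \<alpha> \<nu> \<eta>\<^sub>F \<eta>\<^sub>F\<^sub>L \<eta>\<^sub>L \<rho> w\<^sub>d \<psi> \<mu> f\<^sub>F f\<^sub>L \<longleftrightarrow>
     (\<forall>t\<ge>0. opinion_distribution 1 (f\<^sub>F t) \<and> opinion_distribution \<rho> (f\<^sub>L t)) \<and>
     (\<forall>\<phi>. smooth \<phi> \<longrightarrow> (\<forall>t\<ge>0.
        ((\<lambda>s. LINT w|f\<^sub>F s. \<phi> w) has_real_derivative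
           \<eta>\<^sub>F * (LINT (w, v)|(f\<^sub>F t \<Otimes>\<^sub>M f\<^sub>F t). \<phi> (post_FF \<alpha> w v) - \<phi> w) +
           \<eta>\<^sub>F\<^sub>L * (LINT (w, v)|(f\<^sub>F t \<Otimes>\<^sub>M f\<^sub>L t). \<phi> (post_LF \<alpha> w v) - \<phi> w))
          (at t within {0..}) \<and>
        ((\<lambda>s. LINT w|f\<^sub>L s. \<phi> w) has_real_derivative
           \<eta>\<^sub>L * (LINT (w, v)|(f\<^sub>L t \<Otimes>\<^sub>M f\<^sub>L t).
                    \<phi> (post_LL \<alpha> \<nu> \<psi> \<mu> w\<^sub>d (mean_F (f\<^sub>F t)) w v) - \<phi> w))
          (at t within {0..})))"

definition dirac :: "real \<Rightarrow> real measure" where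
  "dirac x = return opinion_space x"

definition weakly_tends_to :: "(real \<Rightarrow> real measure) \<Rightarrow> real measure \<Rightarrow> bool" where
  "weakly_tends_to f g \<longleftrightarrow>
     (\<forall>\<phi>::real \<Rightarrow> real. continuous_on opinions \<phi> \<longrightarrow>
        ((\<lambda>t. LINT w|f t. \<phi> w) \<longlongrightarrow> (LINT w|g. \<phi> w)) at_top)"

definition steady_state :: "(real \<Rightarrow> real measure) \<Rightarrow> bool" where
  "steady_state f \<longleftrightarrow> (\<forall>t\<ge>0. f t = f 0)"

end

theory Submission
  imports Defs
begin

text \<open>
  Every post-interaction opinion is an affine function \<open>p (w - w\<^sub>d) + q (v - w\<^sub>d) + r\<close> of the
  two opinions measured from the target. Testing the Boltzmann equations with \<open>w - w\<^sub>d\<close> and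
  \<open>(w - w\<^sub>d)\<^sup>2\<close> therefore gives a closed system of ordinary differential equations for the
  first and second centred moments (\<open>boltzmann_moment_equations\<close>).

  The means satisfy a linear planar system by themselves. When \<open>\<psi> > 0\<close> a weighted sum of squares
  of the two deviations is a strict Lyapunov function, so both means tend to \<open>w\<^sub>d\<close>
  (\<open>linear_mean_system_decay\<close>).

  Each second moment satisfies \<open>e' = - k e + g\<close>, and once the means converge the forcing \<open>g\<close>
  tends to 0: for the leaders it is quadratic in the means, and for the followers it also contains
  the leaders' second moment, which has to be treated first. Such an \<open>e\<close> tends to 0 as soon
  as \<open>k > 0\<close> (\<open>forced_decay\<close>). The sign of \<open>k\<close> is where admissibility of the interactions
  enters. For the leaders \<open>k\<close> is a positive multiple of \<open>1 - p\<^sup>2 - q\<^sup>2\<close>; an affine map that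
  keeps opinions inside the interval has \<open>\<bar>p\<bar> + \<bar>q\<bar> \<le> 1\<close>, while the control forces
  \<open>p + q = 1 - \<beta>\<close> with \<open>0 < \<beta> < 1\<close>, which excludes \<open>p\<^sup>2 + q\<^sup>2 = 1\<close>. For the followers
  the same bound yields \<open>\<alpha> \<le> 1\<close>.

  A vanishing second moment about \<open>w\<^sub>d\<close> forces weak convergence to the Dirac mass
  (\<open>weakly_tends_to_dirac\<close>). For a stationary solution the second moment is constant, hence 0,
  and the measure is that Dirac mass.
\<close>

section \<open>Quadratic test functions\<close>

text \<open>Smoothness constrains iterated derivatives, and differentiation maps the quadratics centred
  at \<open>c\<close> into themselves; the induction therefore needs the whole family.\<close>
lemma deriv_funpow_quadratic:
  fixes a b d c :: real
  shows "\<exists>a' b' d'. (deriv ^^ n) (\<lambda>w. a * (w - c)\<^sup>2 + b * (w - c) + d)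
           = (\<lambda>w. a' * (w - c)\<^sup>2 + b' * (w - c) + d')"
proof (induction n arbitrary: a b d)
  case 0
  show ?case by auto
next
  case (Suc n)
  have "deriv (\<lambda>w. a * (w - c)\<^sup>2 + b * (w - c) + d) = (\<lambda>w. 0 * (w - c)\<^sup>2 + (2 * a) * (w - c) + b)"
    by (rule ext, rule DERIV_imp_deriv) (auto intro!: derivative_eq_intros)
  then show ?case using Suc[of 0 "2 * a" b] by (simp add: funpow_swap1 del: mult_zero_left)
qed

lemma smooth_quadratic: "smooth (\<lambda>w. a * (w - c)\<^sup>2 + b * (w - c) + d)"
  unfolding smooth_def
proof (intro allI)
  fix n x
  obtain a' b' d' where "(deriv ^^ n) (\<lambda>w. a * (w - c)\<^sup>2 + b * (w - c) + d)
           = (\<lambda>w. a' * (w - c)\<^sup>2 + b' * (w - c) + d')"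
    using deriv_funpow_quadratic by blast
  then show "(deriv ^^ n) (\<lambda>w. a * (w - c)\<^sup>2 + b * (w - c) + d) differentiable at x"
    by (auto intro!: derivative_intros)
qed

lemma smooth_centred: "smooth (\<lambda>w. w - c)" "smooth (\<lambda>w. (w - c)\<^sup>2)"
  using smooth_quadratic[of 0 c 1 0] smooth_quadratic[of 1 c 0 0] by simp_all

section \<open>Opinion distributions and their centred moments\<close>

definition moment :: "real \<Rightarrow> nat \<Rightarrow> real measure \<Rightarrow> real" where
  "moment c k M = (LINT w|M. (w - c) ^ k)"

lemma opinion_distributionD:
  assumes "opinion_distribution m M" "0 \<le> m"
  shows "finite_measure M" "space M = {-1..1}" "measure M (space M) = m"
    "sets M = sets (restrict_space borel {-1..1})"
proof -
  show s: "sets M = sets (restrict_space borel {-1..1})"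
    using assms by (simp add: opinion_distribution_def opinion_space_def opinions_def)
  show "space M = {-1..1}"
    using sets_eq_imp_space_eq[OF s] by (simp add: space_restrict_space)
  show "finite_measure M" "measure M (space M) = m"
    using assms by (auto simp: opinion_distribution_def measure_def intro!: finite_measureI)
qed

lemma opinion_measurable:
  assumes "opinion_distribution m M" "0 \<le> m" "continuous_on {-1..1} \<phi>"
  shows "\<phi> \<in> borel_measurable M"
  using borel_measurable_continuous_on_restrict[OF assms(3)]
    measurable_cong_sets[OF opinion_distributionD(4)[OF assms(1,2)] refl] by blast

lemma opinion_integrable:
  fixes \<phi> :: "real \<Rightarrow> real"
  assumes "opinion_distribution m M" "0 \<le> m" "continuous_on {-1..1} \<phi>"
  shows "integrable M \<phi>"
proof -
  interpret finite_measure M using assms(1,2) by (rule opinion_distributionD)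
  have "compact (\<phi> ` {-1..1})" using assms(3) by (intro compact_continuous_image) auto
  then obtain B where "\<And>w. w \<in> {-1..1} \<Longrightarrow> norm (\<phi> w) \<le> B"
    using compact_imp_bounded bounded_iff by (metis imageI)
  then show ?thesis
    using opinion_distributionD(2)[OF assms(1,2)] opinion_measurable[OF assms]
    by (intro integrable_const_bound[where B=B]) (auto intro!: AE_I2)
qed

text \<open>Opinions are bounded, so all the integrals below exist; the mass enters through the constant
  term.\<close>
lemma integral_opinion_quadratic:
  assumes "opinion_distribution m M" "0 \<le> m"
  shows "(LINT w|M. a * (w - c)\<^sup>2 + b * (w - c) + d) = a * moment c 2 M + b * moment c 1 M + d * m"
proof -
  have [simp]: "integrable M (\<lambda>w. (w - c)\<^sup>2)" "integrable M (\<lambda>w. w - c)" "integrable M (\<lambda>w. d)"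
    by (rule opinion_integrable[OF assms]; intro continuous_intros)+
  show ?thesis
    using opinion_distributionD(3)[OF assms] by (simp add: moment_def)
qed

lemma moment_2_nonneg: "0 \<le> moment c 2 M"
  by (simp add: moment_def)

lemma mean_conv_moment:
  assumes "opinion_distribution m M" "0 \<le> m"
  shows "(LINT w|M. w) = moment c 1 M + c * m"
    and "(LINT w|M. w\<^sup>2) = moment c 2 M + 2 * c * moment c 1 M + c\<^sup>2 * m"
proof -
  show "(LINT w|M. w) = moment c 1 M + c * m"
    using integral_opinion_quadratic[OF assms, where a=0 and c=c and b=1 and d=c] by simp
  have "(\<lambda>w. w\<^sup>2) = (\<lambda>w. 1 * (w - c)\<^sup>2 + (2 * c) * (w - c) + c\<^sup>2)"
    by (auto simp: power2_eq_square algebra_simps)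
  then show "(LINT w|M. w\<^sup>2) = moment c 2 M + 2 * c * moment c 1 M + c\<^sup>2 * m"
    using integral_opinion_quadratic[OF assms, where a=1 and c=c and b="2*c" and d="c\<^sup>2"]
    by (simp only:)
qed

text \<open>By Fubini: for a fixed first opinion the integrand is a centred quadratic in the second, and
  integrating it out leaves a centred quadratic in the first.\<close>
lemma integral_pair_quadratic:
  assumes M: "opinion_distribution m M" "0 \<le> m" and N: "opinion_distribution n N" "0 \<le> n"
  shows "(LINT (w, v)|(M \<Otimes>\<^sub>M N). a * (w - c)\<^sup>2 + b * ((w - c) * (v - c)) + d * (v - c)\<^sup>2
            + e * (w - c) + g * (v - c) + h)
       = a * n * moment c 2 M + b * (moment c 1 M * moment c 1 N) + d * m * moment c 2 N
            + e * n * moment c 1 M + g * m * moment c 1 N + h * m * n"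
    (is "(LINT (w, v)|_. ?Q w v) = _")
proof -
  interpret M: finite_measure M using M by (rule opinion_distributionD)
  interpret N: finite_measure N using N by (rule opinion_distributionD)
  interpret pair_sigma_finite M N ..
  interpret P: finite_measure "M \<Otimes>\<^sub>M N"
    by (intro finite_measure_pair_measure) unfold_locales
  have [measurable]: "(\<lambda>w. w) \<in> borel_measurable M" "(\<lambda>w. w) \<in> borel_measurable N"
    using M N by (auto intro!: opinion_measurable continuous_intros)
  have sp: "space (M \<Otimes>\<^sub>M N) = {-1..1} \<times> {-1..1}"
    using opinion_distributionD(2) M N by (simp add: space_pair_measure)
  have "compact ((\<lambda>(w, v). ?Q w v) ` ({-1..1} \<times> {-1..1}))"
    by (intro compact_continuous_image compact_Times)
      (auto simp: case_prod_unfold intro!: continuous_intros)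
  then obtain B where "\<forall>y \<in> (\<lambda>(w, v). ?Q w v) ` ({-1..1} \<times> {-1..1}). norm y \<le> B"
    using compact_imp_bounded bounded_iff by blast
  then have "norm ((\<lambda>(w, v). ?Q w v) z) \<le> B" if "z \<in> {-1..1} \<times> {-1..1}" for z
    using that by (rule bspec[OF _ imageI])
  then have "AE z in M \<Otimes>\<^sub>M N. norm ((\<lambda>(w, v). ?Q w v) z) \<le> B"
    unfolding sp[symmetric] by (rule AE_I2)
  moreover have "(\<lambda>(w, v). ?Q w v) \<in> borel_measurable (M \<Otimes>\<^sub>M N)"
    by measurable
  ultimately have int: "integrable (M \<Otimes>\<^sub>M N) (\<lambda>(w, v). ?Q w v)"
    by (rule P.integrable_const_bound)
  have inner: "(LINT v|N. ?Q w v) = (a * n) * (w - c)\<^sup>2 + (b * moment c 1 N + e * n) * (w - c)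
       + (d * moment c 2 N + g * moment c 1 N + h * n)" for w
  proof -
    have "(LINT v|N. ?Q w v) = (LINT v|N. d * (v - c)\<^sup>2 + (b * (w - c) + g) * (v - c)
             + (a * (w - c)\<^sup>2 + e * (w - c) + h))"
      by (rule Bochner_Integration.integral_cong) (auto simp: algebra_simps)
    also have "\<dots> = d * moment c 2 N + (b * (w - c) + g) * moment c 1 N
             + (a * (w - c)\<^sup>2 + e * (w - c) + h) * n"
      by (rule integral_opinion_quadratic[OF N])
    finally show ?thesis by (simp add: algebra_simps)
  qed
  have "(LINT (w, v)|(M \<Otimes>\<^sub>M N). ?Q w v) = (LINT w|M. LINT v|N. ?Q w v)"
    by (rule integral_fst[OF int, symmetric])
  also have "\<dots> = (a * n) * moment c 2 M + (b * moment c 1 N + e * n) * moment c 1 M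
       + (d * moment c 2 N + g * moment c 1 N + h * n) * m"
    unfolding inner by (rule integral_opinion_quadratic[OF M])
  finally show ?thesis by (simp add: algebra_simps)
qed

section \<open>Affine interactions\<close>

text \<open>This is what closes the hierarchy: the gain and loss of a centred moment of order at most 2 in
  an affine interaction involve only moments of order at most 2. The three interactions of the model
  are instances of it.\<close>
lemma collision_moments:
  assumes M: "opinion_distribution m M" "0 \<le> m" and N: "opinion_distribution n N" "0 \<le> n"
    and T: "\<And>w v. T w v - c = p * (w - c) + q * (v - c) + r"
  shows "(LINT (w, v)|(M \<Otimes>\<^sub>M N). (T w v - c) - (w - c))
           = (p - 1) * n * moment c 1 M + q * m * moment c 1 N + r * m * n" (is ?th1)
    and "(LINT (w, v)|(M \<Otimes>\<^sub>M N). (T w v - c)\<^sup>2 - (w - c)\<^sup>2)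
           = (p\<^sup>2 - 1) * n * moment c 2 M + 2 * p * q * (moment c 1 M * moment c 1 N)
             + q\<^sup>2 * m * moment c 2 N
             + 2 * p * r * n * moment c 1 M + 2 * q * r * m * moment c 1 N + r\<^sup>2 * m * n" (is ?th2)
proof -
  have "(T w v - c) - (w - c) = 0 * (w - c)\<^sup>2 + 0 * ((w - c) * (v - c)) + 0 * (v - c)\<^sup>2
            + (p - 1) * (w - c) + q * (v - c) + r" for w v
    by (simp add: T algebra_simps)
  then show ?th1
    using integral_pair_quadratic[OF M N, of 0 c 0 0 "p - 1" q r] by simp
  have "(T w v - c)\<^sup>2 - (w - c)\<^sup>2 = (p\<^sup>2 - 1) * (w - c)\<^sup>2 + (2 * p * q) * ((w - c) * (v - c))
            + q\<^sup>2 * (v - c)\<^sup>2 + (2 * p * r) * (w - c) + (2 * q * r) * (v - c) + r\<^sup>2" for w v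
    unfolding T by (simp add: power2_eq_square algebra_simps)
  then show ?th2
    using integral_pair_quadratic[OF M N, of "p\<^sup>2 - 1" c "2 * p * q" "q\<^sup>2" "2 * p * r" "2 * q * r" "r\<^sup>2"]
    by (simp only:)
qed

text \<open>The image of the square of opinion pairs is an interval of length \<open>2 (\<bar>p\<bar> + \<bar>q\<bar>)\<close>, whatever
  the offset \<open>r\<close>, and it has to fit into \<open>[-1, 1]\<close>.\<close>
lemma affine_contraction:
  assumes "\<And>w v. w \<in> opinions \<Longrightarrow> v \<in> opinions \<Longrightarrow> p * w + q * v + r \<in> opinions"
  shows "\<bar>p\<bar> + \<bar>q\<bar> \<le> 1"
  using assms[of 1 1] assms[of 1 "-1"] assms[of "-1" 1] assms[of "-1" "-1"]
  by (auto simp: opinions_def)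

text \<open>On the square \<open>\<bar>p\<bar> + \<bar>q\<bar> \<le> 1\<close> the Euclidean norm reaches 1 only at the four corners, and there
  \<open>\<bar>p + q\<bar> = 1\<close>.\<close>
lemma sum_squares_less_1:
  fixes p q :: real
  assumes "\<bar>p\<bar> + \<bar>q\<bar> \<le> 1" "\<bar>p + q\<bar> < 1"
  shows "p\<^sup>2 + q\<^sup>2 < 1"
proof (cases "p * q \<ge> 0")
  case True
  have "p\<^sup>2 + q\<^sup>2 \<le> (p + q)\<^sup>2" using True by (simp add: power2_sum)
  also have "\<dots> < 1" using assms(2) by (simp add: abs_square_less_1)
  finally show ?thesis .
next
  case False
  have "(\<bar>p\<bar> + \<bar>q\<bar>)\<^sup>2 \<le> 1" using assms(1) by (simp add: abs_square_le_1)
  moreover have "(\<bar>p\<bar> + \<bar>q\<bar>)\<^sup>2 = p\<^sup>2 + q\<^sup>2 + 2 * \<bar>p * q\<bar>" by (simp add: power2_sum abs_mult)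
  moreover have "\<bar>p * q\<bar> > 0" using False by simp
  ultimately show ?thesis by linarith
qed

text \<open>Because \<open>\<psi> + \<mu> = 1\<close>, the control damps both deviations from the target by \<open>\<beta> / 2\<close>, and the
  followers' mean is felt only through its own deviation from the target, in the offset.\<close>
lemma post_LL_affine:
  assumes "\<psi> + \<mu> = 1"
  shows "post_LL \<alpha> \<nu> \<psi> \<mu> c x w v - c
    = (1 - \<alpha> - control_beta \<alpha> \<nu> / 2) * (w - c) + (\<alpha> - control_beta \<alpha> \<nu> / 2) * (v - c)
      + control_beta \<alpha> \<nu> * \<mu> * (x - c)"
proof -
  have "\<psi> = 1 - \<mu>" using assms by simp
  show ?thesis unfolding \<open>\<psi> = 1 - \<mu>\<close> by (simp add: post_LL_def feedback_def field_simps)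
qed

lemma control_beta_bounds:
  assumes "\<alpha> > 0" "\<nu> > 0"
  shows "0 < control_beta \<alpha> \<nu>" "control_beta \<alpha> \<nu> < 1"
  using assms by (auto simp: control_beta_def divide_simps add_pos_pos)

section \<open>Decay of solutions of a forced linear differential inequality\<close>

text \<open>Once \<open>g \<le> k \<epsilon>\<close>, the function \<open>(e t - \<epsilon>) exp (k t)\<close> is nonincreasing, so \<open>e\<close> is eventually
  below \<open>2 \<epsilon>\<close>.\<close>
lemma forced_decay:
  fixes e D g :: "real \<Rightarrow> real"
  assumes der: "\<And>t. t \<ge> 0 \<Longrightarrow> (e has_real_derivative D t) (at t within {0..})"
    and D: "\<And>t. t \<ge> 0 \<Longrightarrow> D t \<le> - k * e t + g t"
    and k: "k > 0" and g: "(g \<longlongrightarrow> 0) at_top" and nn: "\<And>t. t \<ge> 0 \<Longrightarrow> 0 \<le> e t"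
  shows "(e \<longlongrightarrow> 0) at_top"
proof (rule order_tendstoI)
  fix a :: real assume "a < 0"
  with nn show "eventually (\<lambda>t. a < e t) at_top"
    by (intro eventually_at_top_linorderI[of 0]) force
next
  fix a :: real assume a: "0 < a"
  define \<epsilon> where "\<epsilon> = a / 2"
  have \<epsilon>: "0 < \<epsilon>" "2 * \<epsilon> = a" using a by (auto simp: \<epsilon>_def)
  have "eventually (\<lambda>t. g t < k * \<epsilon>) at_top"
    using g by (rule order_tendstoD) (use k \<epsilon> in auto)
  then obtain T0 where T0: "\<And>t. t \<ge> T0 \<Longrightarrow> g t < k * \<epsilon>"
    by (auto simp: eventually_at_top_linorder)
  \<comment> \<open>Starting at a positive time keeps away from the one-sided derivative at 0.\<close>
  define T where "T = max T0 1"
  have T: "T > 0" "\<And>t. t \<ge> T \<Longrightarrow> g t < k * \<epsilon>" using T0 by (auto simp: T_def)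
  define h where "h t = (e t - \<epsilon>) * exp (k * t)" for t
  have h: "h t \<le> h T" if "t \<ge> T" for t
  proof (rule DERIV_nonpos_imp_nonincreasing[OF that])
    fix x assume x: "T \<le> x" "x \<le> t"
    then have "(e has_real_derivative D x) (at x)"
      using der[of x] T(1) at_within_interior[of x "{0..}"] by (simp add: interior_real_atLeast)
    then have "(h has_real_derivative (D x + k * (e x - \<epsilon>)) * exp (k * x)) (at x)"
      unfolding h_def by (auto intro!: derivative_eq_intros simp: algebra_simps)
    moreover have "D x + k * (e x - \<epsilon>) \<le> 0"
      using D[of x] T x by (smt (verit) right_diff_distrib mult_minus_left)
    ultimately show "\<exists>y. (h has_real_derivative y) (at x) \<and> y \<le> 0"
      by (meson exp_ge_zero mult_nonpos_nonneg)
  qed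
  have "((\<lambda>t. \<epsilon> + h T * exp (- k * t)) \<longlongrightarrow> \<epsilon> + h T * 0) at_top"
    using k by (intro tendsto_intros filterlim_compose[OF exp_at_bot]
        filterlim_tendsto_neg_mult_at_bot[OF tendsto_const] filterlim_ident) auto
  then have "eventually (\<lambda>t. \<epsilon> + h T * exp (- k * t) < a) at_top"
    by (rule order_tendstoD) (use \<epsilon> in auto)
  then show "eventually (\<lambda>t. e t < a) at_top"
    using eventually_ge_at_top[of T]
  proof eventually_elim
    case (elim t)
    have "e t = \<epsilon> + h t * exp (- k * t)"
      by (simp add: h_def mult.assoc flip: exp_add)
    also have "\<dots> \<le> \<epsilon> + h T * exp (- k * t)" using h[OF elim(2)] by simp
    finally show ?case using elim(1) by simp
  qed
qed

section \<open>Concentration\<close>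

lemma dirac_eqI:
  assumes M: "opinion_distribution m M" "0 \<le> m" and c: "c \<in> opinions"
    and ae: "AE w in M. w = c"
  shows "M = scale_measure (ennreal m) (dirac c)"
proof (rule measure_eqI)
  show s: "sets M = sets (scale_measure (ennreal m) (dirac c))"
    using M by (simp add: opinion_distribution_def dirac_def)
  fix A assume A: "A \<in> sets M"
  have A': "A \<in> sets opinion_space" using A M by (simp add: opinion_distribution_def)
  have cs: "c \<in> space M" using c opinion_distributionD(2)[OF M] by (simp add: opinions_def)
  have "emeasure M A = emeasure M (if c \<in> A then space M else {})"
    by (rule emeasure_eq_AE) (use ae A cs in auto)
  also have "\<dots> = ennreal m * indicator A c"
    using M by (simp add: opinion_distribution_def)
  also have "\<dots> = emeasure (scale_measure (ennreal m) (dirac c)) A"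
    using A' by (simp add: dirac_def)
  finally show "emeasure M A = emeasure (scale_measure (ennreal m) (dirac c)) A" .
qed

lemma opinion_distribution_dirac:
  assumes "c \<in> opinions"
  shows "opinion_distribution m (scale_measure (ennreal m) (dirac c))"
proof -
  have "space opinion_space = opinions" by (simp add: opinion_space_def space_restrict_space)
  moreover have "opinions \<in> sets opinion_space" using sets.top[of opinion_space] calculation by simp
  ultimately show ?thesis
    using assms by (simp add: opinion_distribution_def dirac_def space_scale_measure)
qed

lemma integral_scaled_dirac:
  fixes \<phi> :: "real \<Rightarrow> real"
  assumes c: "c \<in> opinions" and m: "0 \<le> m" and \<phi>: "continuous_on opinions \<phi>"
  shows "(LINT w|scale_measure (ennreal m) (dirac c). \<phi> w) = m * \<phi> c"
proof -
  let ?M = "scale_measure (ennreal m) (dirac c)"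
  note M = opinion_distribution_dirac[OF c, of m] m
  have "(LINT w|?M. \<phi> w) = (LINT w|?M. \<phi> c)"
  proof (rule integral_cong_AE)
    show "\<phi> \<in> borel_measurable ?M"
      by (rule opinion_measurable[OF M]) (use \<phi> in \<open>simp add: opinions_def\<close>)
    have ms: "{w \<in> space opinion_space. w \<noteq> c} \<in> sets opinion_space"
      by (auto simp: opinion_space_def sets_restrict_space space_restrict_space image_iff
          intro!: bexI[of _ "- {c}"])
    show "AE w in ?M. \<phi> w = \<phi> c"
      by (rule AE_I[where N="{w \<in> space opinion_space. w \<noteq> c}"])
        (use ms in \<open>auto simp: dirac_def space_scale_measure\<close>)
  qed simp
  then show ?thesis using opinion_distributionD(3)[OF M] by simp
qed

lemma concentrated_at_centre:
  assumes M: "opinion_distribution m M" "0 \<le> m" and "moment c 2 M = 0"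
  shows "AE w in M. w = c"
proof -
  have "integrable M (\<lambda>w. (w - c)\<^sup>2)"
    by (rule opinion_integrable[OF M]; intro continuous_intros)
  then have "AE w in M. (w - c)\<^sup>2 = 0"
    using assms(3) by (simp add: moment_def integral_nonneg_eq_0_iff_AE)
  then show ?thesis by simp
qed

text \<open>Near \<open>c\<close> continuity gives the bound \<open>\<epsilon>\<close>; at distance at least \<open>d\<close> the oscillation of the bounded
  function \<open>\<phi>\<close> is paid for by \<open>(w - c)\<^sup>2 / d\<^sup>2 \<ge> 1\<close>.\<close>
lemma quadratic_modulus:
  fixes \<phi> :: "real \<Rightarrow> real"
  assumes \<phi>: "continuous_on opinions \<phi>" and c: "c \<in> opinions" and \<epsilon>: "\<epsilon> > 0"
  obtains C where "C \<ge> 0" "\<And>w. w \<in> opinions \<Longrightarrow> \<bar>\<phi> w - \<phi> c\<bar> \<le> \<epsilon> + C * (w - c)\<^sup>2"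
proof -
  obtain d where d: "d > 0" "\<And>w. w \<in> opinions \<Longrightarrow> dist w c < d \<Longrightarrow> dist (\<phi> w) (\<phi> c) < \<epsilon>"
    using \<phi> c \<epsilon> unfolding continuous_on_iff by metis
  have "compact (\<phi> ` opinions)" using \<phi> by (intro compact_continuous_image) (auto simp: opinions_def)
  then obtain B where B: "B > 0" "\<And>w. w \<in> opinions \<Longrightarrow> \<bar>\<phi> w\<bar> \<le> B"
    using compact_imp_bounded bounded_pos by (metis imageI real_norm_def)
  show thesis
  proof (rule that[of "2 * B / d\<^sup>2"])
    show "0 \<le> 2 * B / d\<^sup>2" using B by simp
    fix w assume w: "w \<in> opinions"
    show "\<bar>\<phi> w - \<phi> c\<bar> \<le> \<epsilon> + 2 * B / d\<^sup>2 * (w - c)\<^sup>2"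
    proof (cases "dist w c < d")
      case True
      have "0 \<le> 2 * B / d\<^sup>2 * (w - c)\<^sup>2" using B by simp
      then show ?thesis using d(2)[OF w True] by (simp add: dist_real_def)
    next
      case False
      then have "d\<^sup>2 \<le> (w - c)\<^sup>2"
        using d(1) by (simp add: dist_real_def abs_le_square_iff[symmetric])
      then have "2 * B * 1 \<le> 2 * B * ((w - c)\<^sup>2 / d\<^sup>2)" 
        using B d(1) by (intro mult_left_mono) auto
      then show ?thesis using B(2)[OF w] B(2)[OF c] \<epsilon> by simp
    qed
  qed
qed

text \<open>A quantitative Chebyshev argument: integrating the bound of \<open>quadratic_modulus\<close> controls the
  error by \<open>\<epsilon> m\<close> plus a multiple of the second moment.\<close>
lemma weakly_tends_to_dirac:
  assumes M: "\<And>t. t \<ge> 0 \<Longrightarrow> opinion_distribution m (f t)" "0 \<le> m" and c: "c \<in> opinions"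
    and lim: "((\<lambda>t. moment c 2 (f t)) \<longlongrightarrow> 0) at_top"
  shows "weakly_tends_to f (scale_measure (ennreal m) (dirac c))"
  unfolding weakly_tends_to_def
proof (intro allI impI)
  fix \<phi> :: "real \<Rightarrow> real" assume \<phi>: "continuous_on opinions \<phi>"
  have \<phi>': "continuous_on {-1..1} \<phi>" using \<phi> by (simp add: opinions_def)
  have "((\<lambda>t. LINT w|f t. \<phi> w) \<longlongrightarrow> m * \<phi> c) at_top"
  proof (rule tendstoI)
    fix a :: real assume a: "0 < a"
    define \<epsilon> where "\<epsilon> = a / (2 * (m + 1))"
    have \<epsilon>: "\<epsilon> > 0" "\<epsilon> * m < a" using a M(2) by (auto simp: \<epsilon>_def field_simps add_nonneg_pos)
    obtain C where C: "C \<ge> 0" "\<And>w. w \<in> opinions \<Longrightarrow> \<bar>\<phi> w - \<phi> c\<bar> \<le> \<epsilon> + C * (w - c)\<^sup>2"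
      using quadratic_modulus[OF \<phi> c \<epsilon>(1)] by blast
    have "((\<lambda>t. C * moment c 2 (f t) + \<epsilon> * m) \<longlongrightarrow> C * 0 + \<epsilon> * m) at_top"
      by (intro tendsto_intros lim)
    then have "eventually (\<lambda>t. C * moment c 2 (f t) + \<epsilon> * m < a) at_top"
      by (rule order_tendstoD) (use \<epsilon> in auto)
    then show "eventually (\<lambda>t. dist (LINT w|f t. \<phi> w) (m * \<phi> c) < a) at_top"
      using eventually_ge_at_top[of 0]
    proof eventually_elim
      case (elim t)
      note ft = M(1)[OF elim(2)] M(2)
      note ii = opinion_integrable[OF ft] 
      have i: "integrable (f t) \<phi>" by (rule ii[OF \<phi>'])
      have ic: "integrable (f t) (\<lambda>w. \<phi> c)" by (rule ii) (intro continuous_intros)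
      have "(LINT w|f t. \<phi> w) - m * \<phi> c = (LINT w|f t. \<phi> w - \<phi> c)"
        using opinion_distributionD(3)[OF ft] i ic by simp
      then have "dist (LINT w|f t. \<phi> w) (m * \<phi> c) \<le> (LINT w|f t. \<bar>\<phi> w - \<phi> c\<bar>)"
        using integral_abs_bound[of "f t" "\<lambda>w. \<phi> w - \<phi> c"] by (simp add: dist_real_def)
      also have "\<dots> \<le> (LINT w|f t. C * (w - c)\<^sup>2 + 0 * (w - c) + \<epsilon>)"
      proof (rule integral_mono)
        show "integrable (f t) (\<lambda>w. \<bar>\<phi> w - \<phi> c\<bar>)"
          using i ic by auto
        show "integrable (f t) (\<lambda>w. C * (w - c)\<^sup>2 + 0 * (w - c) + \<epsilon>)"
          by (rule ii) (intro continuous_intros)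
        show "\<bar>\<phi> w - \<phi> c\<bar> \<le> C * (w - c)\<^sup>2 + 0 * (w - c) + \<epsilon>" if "w \<in> space (f t)" for w
          using C(2)[of w] that opinion_distributionD(2)[OF ft] by (simp add: opinions_def)
      qed
      also have "\<dots> = C * moment c 2 (f t) + \<epsilon> * m"
        using integral_opinion_quadratic[OF ft, of C c 0 \<epsilon>] by simp
      finally show ?case using elim(1) by simp
    qed
  qed
  then show "((\<lambda>t. LINT w|f t. \<phi> w) \<longlongrightarrow> (LINT w|scale_measure (ennreal m) (dirac c). \<phi> w)) at_top"
    using integral_scaled_dirac[OF c M(2) \<phi>] by simp
qed

section \<open>The moment equations\<close>

text \<open>Here \<open>y\<close> and \<open>Y\<close> are moments of the unnormalised leader measure of mass \<open>\<rho>\<close>; the deviation of the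
  leaders' mean is \<open>y t / \<rho>\<close>. Followers' interactions among themselves conserve the mean, so \<open>\<eta>\<^sub>F\<close>
  is absent from the first equation. In each second-moment equation the damping term is separated
  from a forcing term.\<close>
lemma boltzmann_moment_equations:
  fixes \<psi> \<mu> :: real
  assumes sol: "boltzmann_solution \<alpha> \<nu> \<eta>\<^sub>F \<eta>\<^sub>F\<^sub>L \<eta>\<^sub>L \<rho> c \<psi> \<mu> f\<^sub>F f\<^sub>L"
    and \<rho>: "0 \<le> \<rho>" and \<psi>\<mu>: "\<psi> + \<mu> = 1"
    and x_def: "x = (\<lambda>s. moment c 1 (f\<^sub>F s))" and y_def: "y = (\<lambda>s. moment c 1 (f\<^sub>L s))"
    and X_def: "X = (\<lambda>s. moment c 2 (f\<^sub>F s))" and Y_def: "Y = (\<lambda>s. moment c 2 (f\<^sub>L s))"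
    and \<beta>_def: "\<beta> = control_beta \<alpha> \<nu>"
    and p_def: "p = 1 - \<alpha> - \<beta> / 2" and q_def: "q = \<alpha> - \<beta> / 2"
    and t: "t \<ge> 0"
  shows "(x has_real_derivative \<eta>\<^sub>F\<^sub>L * \<alpha> * (y t - \<rho> * x t)) (at t within {0..})"
    and "(y has_real_derivative - (\<eta>\<^sub>L * \<beta> * \<rho>) * (y t - \<mu> * (\<rho> * x t))) (at t within {0..})"
    and "(X has_real_derivative
           - (2 * \<eta>\<^sub>F * \<alpha> * (1 - \<alpha>) + \<eta>\<^sub>F\<^sub>L * \<rho> * \<alpha> * (2 - \<alpha>)) * X t
           + (2 * \<eta>\<^sub>F * \<alpha> * (1 - \<alpha>) * (x t)\<^sup>2
              + \<eta>\<^sub>F\<^sub>L * (2 * \<alpha> * (1 - \<alpha>) * (x t * y t) + \<alpha>\<^sup>2 * Y t))) (at t within {0..})"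
    and "(Y has_real_derivative
           - (\<eta>\<^sub>L * \<rho> * (1 - (p\<^sup>2 + q\<^sup>2))) * Y t
           + \<eta>\<^sub>L * (2 * p * q * (y t)\<^sup>2 + 2 * (p + q) * \<beta> * \<mu> * \<rho> * (x t * y t)
              + (\<beta> * \<mu> * \<rho>)\<^sup>2 * (x t)\<^sup>2)) (at t within {0..})"
proof -
  have F: "opinion_distribution 1 (f\<^sub>F t)" and L: "opinion_distribution \<rho> (f\<^sub>L t)"
    using sol t by (auto simp: boltzmann_solution_def)
  have dF: "((\<lambda>s. LINT w|f\<^sub>F s. \<phi> w) has_real_derivative
           \<eta>\<^sub>F * (LINT (w, v)|(f\<^sub>F t \<Otimes>\<^sub>M f\<^sub>F t). \<phi> (post_FF \<alpha> w v) - \<phi> w) +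
           \<eta>\<^sub>F\<^sub>L * (LINT (w, v)|(f\<^sub>F t \<Otimes>\<^sub>M f\<^sub>L t). \<phi> (post_LF \<alpha> w v) - \<phi> w)) (at t within {0..})"
    and dL: "((\<lambda>s. LINT w|f\<^sub>L s. \<phi> w) has_real_derivative
           \<eta>\<^sub>L * (LINT (w, v)|(f\<^sub>L t \<Otimes>\<^sub>M f\<^sub>L t).
                    \<phi> (post_LL \<alpha> \<nu> \<psi> \<mu> c (mean_F (f\<^sub>F t)) w v) - \<phi> w)) (at t within {0..})"
    if "smooth \<phi>" for \<phi>
    using sol t that by (auto simp: boltzmann_solution_def)
  have mF: "mean_F (f\<^sub>F t) - c = x t"
    using mean_conv_moment(1)[OF F, of c] by (simp add: mean_F_def x_def)
  have FF: "post_FF \<alpha> w v - c = (1 - \<alpha>) * (w - c) + \<alpha> * (v - c) + 0"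
    and LF: "post_LF \<alpha> w v - c = (1 - \<alpha>) * (w - c) + \<alpha> * (v - c) + 0" for w v
    by (simp_all add: post_FF_def post_LF_def algebra_simps)
  have LL: "post_LL \<alpha> \<nu> \<psi> \<mu> c (mean_F (f\<^sub>F t)) w v - c = p * (w - c) + q * (v - c) + \<beta> * \<mu> * x t" for w v
    unfolding post_LL_affine[OF \<psi>\<mu>] mF by (simp add: p_def q_def \<beta>_def)
  note collFF = collision_moments[OF F zero_le_one F zero_le_one FF]
  note collLF = collision_moments[OF F zero_le_one L \<rho> LF]
  note collLL = collision_moments[OF L \<rho> L \<rho> LL]
  have x': "x = (\<lambda>s. LINT w|f\<^sub>F s. w - c)" and y': "y = (\<lambda>s. LINT w|f\<^sub>L s. w - c)"
    and X': "X = (\<lambda>s. LINT w|f\<^sub>F s. (w - c)\<^sup>2)" and Y': "Y = (\<lambda>s. LINT w|f\<^sub>L s. (w - c)\<^sup>2)"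
    by (simp_all add: x_def y_def X_def Y_def moment_def)
  have pq: "p = 1 - \<beta> - q" by (simp add: p_def q_def)
  show "(x has_real_derivative \<eta>\<^sub>F\<^sub>L * \<alpha> * (y t - \<rho> * x t)) (at t within {0..})"
    using dF[OF smooth_centred(1)[of c], unfolded collFF collLF, folded x']
    by (rule DERIV_cong) (simp add: x_def y_def algebra_simps)
  show "(y has_real_derivative - (\<eta>\<^sub>L * \<beta> * \<rho>) * (y t - \<mu> * (\<rho> * x t))) (at t within {0..})"
    using dL[OF smooth_centred(1)[of c], unfolded collLL, folded y']
    by (rule DERIV_cong) (simp add: y_def pq algebra_simps)
  show "(X has_real_derivative
           - (2 * \<eta>\<^sub>F * \<alpha> * (1 - \<alpha>) + \<eta>\<^sub>F\<^sub>L * \<rho> * \<alpha> * (2 - \<alpha>)) * X t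
           + (2 * \<eta>\<^sub>F * \<alpha> * (1 - \<alpha>) * (x t)\<^sup>2
              + \<eta>\<^sub>F\<^sub>L * (2 * \<alpha> * (1 - \<alpha>) * (x t * y t) + \<alpha>\<^sup>2 * Y t))) (at t within {0..})"
    using dF[OF smooth_centred(2)[of c], unfolded collFF collLF, folded X']
    by (rule DERIV_cong) (simp add: x_def y_def X_def Y_def power2_eq_square algebra_simps)
  show "(Y has_real_derivative
           - (\<eta>\<^sub>L * \<rho> * (1 - (p\<^sup>2 + q\<^sup>2))) * Y t
           + \<eta>\<^sub>L * (2 * p * q * (y t)\<^sup>2 + 2 * (p + q) * \<beta> * \<mu> * \<rho> * (x t * y t)
              + (\<beta> * \<mu> * \<rho>)\<^sup>2 * (x t)\<^sup>2)) (at t within {0..})"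
    using dL[OF smooth_centred(2)[of c], unfolded collLL, folded Y']
    by (rule DERIV_cong) (simp add: y_def Y_def power2_eq_square algebra_simps)
qed

lemma tendsto_zero_of_power2_le:
  fixes u V :: "real \<Rightarrow> real"
  assumes "(V \<longlongrightarrow> 0) F" "\<And>t. (u t)\<^sup>2 \<le> K * V t"
  shows "(u \<longlongrightarrow> 0) F"
proof -
  have "((\<lambda>t. K * V t) \<longlongrightarrow> K * 0) F" by (intro tendsto_intros assms(1))
  then have "((\<lambda>t. K * V t) \<longlongrightarrow> 0) F" by simp
  then have "((\<lambda>t. (u t)\<^sup>2) \<longlongrightarrow> 0) F"
    by (rule tendsto_0_le[where K=1]) (auto intro!: always_eventually order_trans[OF assms(2)])
  then have "((\<lambda>t. sqrt ((u t)\<^sup>2)) \<longlongrightarrow> sqrt 0) F" by (rule tendsto_real_sqrt)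
  then show ?thesis by (simp add: tendsto_rabs_zero_iff)
qed

text \<open>The weights of \<open>V = x\<^sup>2 / (2 a) + z\<^sup>2 / (2 b)\<close> cancel the rates, so that
  \<open>V' = - (x\<^sup>2 - (1 + \<mu>) x z + z\<^sup>2)\<close>. This form is negative definite exactly when \<open>1 + \<mu> < 2\<close>, that
  is when \<open>\<psi> > 0\<close>.\<close>
lemma linear_mean_system_decay:
  fixes x z :: "real \<Rightarrow> real"
  assumes a: "a > 0" and b: "b > 0" and \<psi>: "\<psi> > 0" and \<psi>\<mu>: "\<psi> + \<mu> = 1" and \<mu>: "\<mu> \<ge> 0"
    and x: "\<And>t. t \<ge> 0 \<Longrightarrow> (x has_real_derivative a * (z t - x t)) (at t within {0..})"
    and z: "\<And>t. t \<ge> 0 \<Longrightarrow> (z has_real_derivative - b * (z t - \<mu> * x t)) (at t within {0..})"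
  shows "(x \<longlongrightarrow> 0) at_top" "(z \<longlongrightarrow> 0) at_top"
proof -
  define V where "V t = (x t)\<^sup>2 / (2 * a) + (z t)\<^sup>2 / (2 * b)" for t
  \<comment> \<open>The form dominates \<open>\<psi> / 2\<close> times the sum of squares, and \<open>min a b\<close> converts this into \<open>V\<close>.\<close>
  define k where "k = \<psi> * min a b"
  have "(V \<longlongrightarrow> 0) at_top"
  proof (rule forced_decay[where k = k and g = "\<lambda>t. 0"])
    show "k > 0" using a b \<psi> by (simp add: k_def)
    show "0 \<le> V t" for t using a b by (simp add: V_def)
    fix t :: real assume t: "t \<ge> 0"
    show "(V has_real_derivative (x t * (z t - x t) - z t * (z t - \<mu> * x t))) (at t within {0..})"
      unfolding V_def using a b
      by (auto intro!: derivative_eq_intros x[OF t] z[OF t] simp: field_simps power2_eq_square)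
    have "\<psi> * (min a b / a) * (x t)\<^sup>2 / 2 \<le> \<psi> * 1 * (x t)\<^sup>2 / 2"
      using a \<psi> by (intro divide_right_mono mult_right_mono mult_left_mono) (auto simp: field_simps)
    moreover have "\<psi> * (min a b / b) * (z t)\<^sup>2 / 2 \<le> \<psi> * 1 * (z t)\<^sup>2 / 2"
      using b \<psi> by (intro divide_right_mono mult_right_mono mult_left_mono) (auto simp: field_simps)
    ultimately have kV: "k * V t \<le> \<psi> / 2 * ((x t)\<^sup>2 + (z t)\<^sup>2)"
      using a b by (simp add: k_def V_def algebra_simps)
    have "0 \<le> (1 + \<mu>) / 2 * (x t - z t)\<^sup>2" using \<mu> by simp
    moreover have "x t * (z t - x t) - z t * (z t - \<mu> * x t)
        = - ((1 - \<mu>) / 2 * ((x t)\<^sup>2 + (z t)\<^sup>2)) - (1 + \<mu>) / 2 * (x t - z t)\<^sup>2"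
      by (simp add: power2_eq_square field_simps)
    moreover have "1 - \<mu> = \<psi>" using \<psi>\<mu> by simp
    ultimately show "x t * (z t - x t) - z t * (z t - \<mu> * x t) \<le> - k * V t + 0"
      using kV by simp
  qed simp
  then show "(x \<longlongrightarrow> 0) at_top" "(z \<longlongrightarrow> 0) at_top"
    using a b by (auto intro: tendsto_zero_of_power2_le[of V _ _ "2 * a"]
        tendsto_zero_of_power2_le[of V _ _ "2 * b"] simp: V_def distrib_left)
qed

section \<open>Convergence to consensus\<close>

theorem mainTheorem2:
  fixes \<alpha> \<nu> \<eta>\<^sub>F \<eta>\<^sub>F\<^sub>L \<eta>\<^sub>L \<rho> w\<^sub>d \<psi> \<mu> :: real
    and f\<^sub>F f\<^sub>L :: "real \<Rightarrow> real measure"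
  assumes "\<alpha> > 0" and "\<nu> > 0"
    and "\<eta>\<^sub>F > 0" and "\<eta>\<^sub>F\<^sub>L > 0" and "\<eta>\<^sub>L > 0"
    and "0 < \<rho>" and "\<rho> \<le> 1"
    and "w\<^sub>d \<in> opinions"
    and "\<psi> \<ge> 0" and "\<mu> \<ge> 0" and "\<psi> + \<mu> = 1"
    and "\<And>w v. w \<in> opinions \<Longrightarrow> v \<in> opinions \<Longrightarrow> post_FF \<alpha> w v \<in> opinions"
    and "\<And>w v. w \<in> opinions \<Longrightarrow> v \<in> opinions \<Longrightarrow> post_LF \<alpha> w v \<in> opinions"
    and "\<And>t w v. t \<ge> 0 \<Longrightarrow> w \<in> opinions \<Longrightarrow> v \<in> opinions \<Longrightarrow>
           post_LL \<alpha> \<nu> \<psi> \<mu> w\<^sub>d (mean_F (f\<^sub>F t)) w v \<in> opinions"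
    and "boltzmann_solution \<alpha> \<nu> \<eta>\<^sub>F \<eta>\<^sub>F\<^sub>L \<eta>\<^sub>L \<rho> w\<^sub>d \<psi> \<mu> f\<^sub>F f\<^sub>L"
  shows "(\<forall>t\<ge>0. (LINT w|f\<^sub>F t. (w - w\<^sub>d)\<^sup>2)
                  = energy_F (f\<^sub>F t) + w\<^sub>d\<^sup>2 - 2 * mean_F (f\<^sub>F t) * w\<^sub>d) \<and>
         (\<forall>t\<ge>0. 1 / \<rho> * (LINT w|f\<^sub>L t. (w - w\<^sub>d)\<^sup>2)
                  = energy_L \<rho> (f\<^sub>L t) + w\<^sub>d\<^sup>2 - 2 * mean_L \<rho> (f\<^sub>L t) * w\<^sub>d) \<and>
         (\<psi> > 0 \<longrightarrow>
            ((\<lambda>t. mean_F (f\<^sub>F t)) \<longlongrightarrow> w\<^sub>d) at_top \<and>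
            ((\<lambda>t. mean_L \<rho> (f\<^sub>L t)) \<longlongrightarrow> w\<^sub>d) at_top) \<and>
         (((\<lambda>t. mean_F (f\<^sub>F t)) \<longlongrightarrow> w\<^sub>d) at_top \<and>
          ((\<lambda>t. mean_L \<rho> (f\<^sub>L t)) \<longlongrightarrow> w\<^sub>d) at_top \<longrightarrow>
            ((\<lambda>t. energy_F (f\<^sub>F t)) \<longlongrightarrow> w\<^sub>d\<^sup>2) at_top \<and>
            ((\<lambda>t. energy_L \<rho> (f\<^sub>L t)) \<longlongrightarrow> w\<^sub>d\<^sup>2) at_top \<and>
            ((\<lambda>t. LINT w|f\<^sub>F t. (w - w\<^sub>d)\<^sup>2) \<longlongrightarrow> 0) at_top \<and>
            ((\<lambda>t. 1 / \<rho> * (LINT w|f\<^sub>L t. (w - w\<^sub>d)\<^sup>2)) \<longlongrightarrow> 0) at_top \<and>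
            weakly_tends_to f\<^sub>F (dirac w\<^sub>d) \<and>
            weakly_tends_to f\<^sub>L (scale_measure (ennreal \<rho>) (dirac w\<^sub>d)) \<and>
            (steady_state f\<^sub>F \<and> steady_state f\<^sub>L \<longrightarrow>
               f\<^sub>F 0 = dirac w\<^sub>d \<and> f\<^sub>L 0 = scale_measure (ennreal \<rho>) (dirac w\<^sub>d)))"
proof -
  note \<alpha> = assms(1) and \<nu> = assms(2) and \<eta> = assms(3-5) and \<rho> = assms(6) and wd = assms(8)
    and \<psi>\<mu> = assms(11) and admFF = assms(12) and admLL = assms(14) and sol = assms(15)
  define x where "x = (\<lambda>s. moment w\<^sub>d 1 (f\<^sub>F s))"
  define y where "y = (\<lambda>s. moment w\<^sub>d 1 (f\<^sub>L s))"
  define X where "X = (\<lambda>s. moment w\<^sub>d 2 (f\<^sub>F s))"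
  define Y where "Y = (\<lambda>s. moment w\<^sub>d 2 (f\<^sub>L s))"
  define \<beta> where "\<beta> = control_beta \<alpha> \<nu>"
  define p where "p = 1 - \<alpha> - \<beta> / 2"
  define q where "q = \<alpha> - \<beta> / 2"
  have \<rho>': "0 \<le> \<rho>" using \<rho> by simp
  have F: "opinion_distribution 1 (f\<^sub>F t)" and L: "opinion_distribution \<rho> (f\<^sub>L t)" if "t \<ge> 0" for t
    using sol that by (auto simp: boltzmann_solution_def)
  note ode = boltzmann_moment_equations[OF sol \<rho>' \<psi>\<mu> x_def y_def X_def Y_def \<beta>_def p_def q_def]
  have \<beta>: "0 < \<beta>" "\<beta> < 1" unfolding \<beta>_def using control_beta_bounds[OF \<alpha> \<nu>] by auto

  have mean_F: "mean_F (f\<^sub>F t) = w\<^sub>d + x t"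
    and mean_L: "mean_L \<rho> (f\<^sub>L t) = w\<^sub>d + y t / \<rho>"
    and energy_F: "energy_F (f\<^sub>F t) = X t + 2 * w\<^sub>d * x t + w\<^sub>d\<^sup>2"
    and energy_L: "energy_L \<rho> (f\<^sub>L t) = Y t / \<rho> + 2 * w\<^sub>d * (y t / \<rho>) + w\<^sub>d\<^sup>2" if "t \<ge> 0" for t
    using mean_conv_moment[OF F[OF that], of w\<^sub>d] mean_conv_moment[OF L[OF that] \<rho>', of w\<^sub>d] \<rho>
    by (simp_all add: mean_F_def mean_L_def energy_F_def energy_L_def x_def y_def X_def Y_def field_simps)
  have X: "(LINT w|f\<^sub>F t. (w - w\<^sub>d)\<^sup>2) = X t" and Y: "(LINT w|f\<^sub>L t. (w - w\<^sub>d)\<^sup>2) = Y t" for t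
    by (simp_all add: X_def Y_def moment_def)

  have variance_F: "(LINT w|f\<^sub>F t. (w - w\<^sub>d)\<^sup>2) = energy_F (f\<^sub>F t) + w\<^sub>d\<^sup>2 - 2 * mean_F (f\<^sub>F t) * w\<^sub>d"
    and variance_L: "1 / \<rho> * (LINT w|f\<^sub>L t. (w - w\<^sub>d)\<^sup>2)
                 = energy_L \<rho> (f\<^sub>L t) + w\<^sub>d\<^sup>2 - 2 * mean_L \<rho> (f\<^sub>L t) * w\<^sub>d" if "t \<ge> 0" for t
    unfolding X Y mean_F[OF that] mean_L[OF that] energy_F[OF that] energy_L[OF that]
    by (simp_all add: power2_eq_square algebra_simps)

  have mean_F_lim: "((\<lambda>t. mean_F (f\<^sub>F t)) \<longlongrightarrow> w\<^sub>d) at_top \<longleftrightarrow> (x \<longlongrightarrow> 0) at_top"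
  proof -
    have "((\<lambda>t. mean_F (f\<^sub>F t)) \<longlongrightarrow> w\<^sub>d) at_top \<longleftrightarrow> ((\<lambda>t. w\<^sub>d + x t) \<longlongrightarrow> w\<^sub>d + 0) at_top"
      by (subst tendsto_cong[where g = "\<lambda>t. w\<^sub>d + x t"])
        (auto intro!: eventually_at_top_linorderI[of 0] mean_F)
    then show ?thesis by (simp only: tendsto_add_const_iff)
  qed
  have mean_L_lim: "((\<lambda>t. mean_L \<rho> (f\<^sub>L t)) \<longlongrightarrow> w\<^sub>d) at_top \<longleftrightarrow> ((\<lambda>t. y t / \<rho>) \<longlongrightarrow> 0) at_top"
  proof -
    have "((\<lambda>t. mean_L \<rho> (f\<^sub>L t)) \<longlongrightarrow> w\<^sub>d) at_top \<longleftrightarrow> ((\<lambda>t. w\<^sub>d + y t / \<rho>) \<longlongrightarrow> w\<^sub>d + 0) at_top"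
      by (subst tendsto_cong[where g = "\<lambda>t. w\<^sub>d + y t / \<rho>"])
        (auto intro!: eventually_at_top_linorderI[of 0] mean_L)
    then show ?thesis by (simp only: tendsto_add_const_iff)
  qed

  have means_converge: "(x \<longlongrightarrow> 0) at_top \<and> ((\<lambda>t. y t / \<rho>) \<longlongrightarrow> 0) at_top" if \<psi>: "\<psi> > 0"
  proof -
    have ab: "\<eta>\<^sub>F\<^sub>L * \<alpha> * \<rho> > 0" "\<eta>\<^sub>L * \<beta> * \<rho> > 0" using \<alpha> \<eta> \<rho> \<beta> by simp_all
    have x': "(x has_real_derivative \<eta>\<^sub>F\<^sub>L * \<alpha> * \<rho> * (y t / \<rho> - x t)) (at t within {0..})"
      if "t \<ge> 0" for t
      using ode(1)[OF that] by (rule DERIV_cong) (use \<rho> in \<open>simp add: field_simps\<close>)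
    have y': "((\<lambda>t. y t / \<rho>) has_real_derivative - (\<eta>\<^sub>L * \<beta> * \<rho>) * (y t / \<rho> - \<mu> * x t)) (at t within {0..})"
      if "t \<ge> 0" for t
      using DERIV_cdivide[OF ode(2)[OF that], of \<rho>]
      by (rule DERIV_cong) (use \<rho> in \<open>simp add: field_simps\<close>)
    show ?thesis
      using linear_mean_system_decay[OF ab \<psi> \<psi>\<mu> assms(10) x' y'] by simp
  qed

  have second_moments_vanish: "(X \<longlongrightarrow> 0) at_top \<and> (Y \<longlongrightarrow> 0) at_top"
    if x0: "(x \<longlongrightarrow> 0) at_top" and z0: "((\<lambda>t. y t / \<rho>) \<longlongrightarrow> 0) at_top"
  proof -
    have y0: "(y \<longlongrightarrow> 0) at_top"
      using tendsto_mult_right_zero[OF z0, of \<rho>] \<rho> by simp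
    have "\<bar>p\<bar> + \<bar>q\<bar> \<le> 1"
    proof (rule affine_contraction)
      fix w v :: real assume wv: "w \<in> opinions" "v \<in> opinions"
      have "post_LL \<alpha> \<nu> \<psi> \<mu> w\<^sub>d (mean_F (f\<^sub>F 0)) w v
          = p * w + q * v + (w\<^sub>d * (1 - p - q) + \<beta> * \<mu> * (mean_F (f\<^sub>F 0) - w\<^sub>d))"
        using post_LL_affine[OF \<psi>\<mu>, of \<alpha> \<nu> w\<^sub>d "mean_F (f\<^sub>F 0)" w v, folded \<beta>_def, folded p_def q_def]
        by (simp add: algebra_simps)
      then show "p * w + q * v + (w\<^sub>d * (1 - p - q) + \<beta> * \<mu> * (mean_F (f\<^sub>F 0) - w\<^sub>d)) \<in> opinions"
        using admLL[of 0, OF _ wv] by simp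
    qed
    then have pq: "p\<^sup>2 + q\<^sup>2 < 1"
      by (rule sum_squares_less_1) (use \<beta> in \<open>simp add: p_def q_def\<close>)
    have Y0: "(Y \<longlongrightarrow> 0) at_top"
    proof (rule forced_decay[OF ode(4)])
      show "\<eta>\<^sub>L * \<rho> * (1 - (p\<^sup>2 + q\<^sup>2)) > 0" using pq \<eta> \<rho> by simp
      have "((\<lambda>t. \<eta>\<^sub>L * (2 * p * q * (y t)\<^sup>2 + 2 * (p + q) * \<beta> * \<mu> * \<rho> * (x t * y t)
              + (\<beta> * \<mu> * \<rho>)\<^sup>2 * (x t)\<^sup>2)) \<longlongrightarrow>
             \<eta>\<^sub>L * (2 * p * q * 0\<^sup>2 + 2 * (p + q) * \<beta> * \<mu> * \<rho> * (0 * 0) + (\<beta> * \<mu> * \<rho>)\<^sup>2 * 0\<^sup>2)) at_top"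
        by (intro tendsto_intros x0 y0)
      then show "((\<lambda>t. \<eta>\<^sub>L * (2 * p * q * (y t)\<^sup>2 + 2 * (p + q) * \<beta> * \<mu> * \<rho> * (x t * y t)
              + (\<beta> * \<mu> * \<rho>)\<^sup>2 * (x t)\<^sup>2)) \<longlongrightarrow> 0) at_top"
        by simp
    qed (auto simp: Y_def moment_2_nonneg)
    have \<alpha>1: "\<alpha> \<le> 1"
      using affine_contraction[of "1 - \<alpha>" \<alpha> 0] admFF by (force simp: post_FF_def algebra_simps)
    have "(X \<longlongrightarrow> 0) at_top"
    proof (rule forced_decay[OF ode(3)])
      show "2 * \<eta>\<^sub>F * \<alpha> * (1 - \<alpha>) + \<eta>\<^sub>F\<^sub>L * \<rho> * \<alpha> * (2 - \<alpha>) > 0"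
        using \<eta> \<rho> \<alpha> \<alpha>1 by (intro add_nonneg_pos) auto
      have "((\<lambda>t. 2 * \<eta>\<^sub>F * \<alpha> * (1 - \<alpha>) * (x t)\<^sup>2
              + \<eta>\<^sub>F\<^sub>L * (2 * \<alpha> * (1 - \<alpha>) * (x t * y t) + \<alpha>\<^sup>2 * Y t)) \<longlongrightarrow>
            2 * \<eta>\<^sub>F * \<alpha> * (1 - \<alpha>) * 0\<^sup>2 + \<eta>\<^sub>F\<^sub>L * (2 * \<alpha> * (1 - \<alpha>) * (0 * 0) + \<alpha>\<^sup>2 * 0)) at_top"
        by (intro tendsto_intros x0 y0 Y0)
      then show "((\<lambda>t. 2 * \<eta>\<^sub>F * \<alpha> * (1 - \<alpha>) * (x t)\<^sup>2
              + \<eta>\<^sub>F\<^sub>L * (2 * \<alpha> * (1 - \<alpha>) * (x t * y t) + \<alpha>\<^sup>2 * Y t)) \<longlongrightarrow> 0) at_top"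
        by simp
    qed (auto simp: X_def moment_2_nonneg)
    with Y0 show ?thesis by simp
  qed

  have consensus: "((\<lambda>t. energy_F (f\<^sub>F t)) \<longlongrightarrow> w\<^sub>d\<^sup>2) at_top \<and>
            ((\<lambda>t. energy_L \<rho> (f\<^sub>L t)) \<longlongrightarrow> w\<^sub>d\<^sup>2) at_top \<and>
            ((\<lambda>t. LINT w|f\<^sub>F t. (w - w\<^sub>d)\<^sup>2) \<longlongrightarrow> 0) at_top \<and>
            ((\<lambda>t. 1 / \<rho> * (LINT w|f\<^sub>L t. (w - w\<^sub>d)\<^sup>2)) \<longlongrightarrow> 0) at_top \<and>
            weakly_tends_to f\<^sub>F (dirac w\<^sub>d) \<and>
            weakly_tends_to f\<^sub>L (scale_measure (ennreal \<rho>) (dirac w\<^sub>d)) \<and>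
            (steady_state f\<^sub>F \<and> steady_state f\<^sub>L \<longrightarrow>
               f\<^sub>F 0 = dirac w\<^sub>d \<and> f\<^sub>L 0 = scale_measure (ennreal \<rho>) (dirac w\<^sub>d))"
    if x0: "(x \<longlongrightarrow> 0) at_top" and z0: "((\<lambda>t. y t / \<rho>) \<longlongrightarrow> 0) at_top"
  proof (intro conjI impI)
    have X0: "(X \<longlongrightarrow> 0) at_top" and Y0: "(Y \<longlongrightarrow> 0) at_top" using second_moments_vanish[OF x0 z0] by auto
    have Y0': "((\<lambda>t. Y t / \<rho>) \<longlongrightarrow> 0) at_top"
      using tendsto_divide_zero[OF Y0] by blast
    have "((\<lambda>t. X t + 2 * w\<^sub>d * x t + w\<^sub>d\<^sup>2) \<longlongrightarrow> 0 + 2 * w\<^sub>d * 0 + w\<^sub>d\<^sup>2) at_top"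
      by (intro tendsto_intros X0 x0)
    then show "((\<lambda>t. energy_F (f\<^sub>F t)) \<longlongrightarrow> w\<^sub>d\<^sup>2) at_top"
      by (subst tendsto_cong[where g = "\<lambda>t. X t + 2 * w\<^sub>d * x t + w\<^sub>d\<^sup>2"])
        (auto intro!: eventually_at_top_linorderI[of 0] energy_F)
    have "((\<lambda>t. Y t / \<rho> + 2 * w\<^sub>d * (y t / \<rho>) + w\<^sub>d\<^sup>2) \<longlongrightarrow> 0 + 2 * w\<^sub>d * 0 + w\<^sub>d\<^sup>2) at_top"
      by (intro tendsto_add tendsto_mult tendsto_const Y0' z0)
    then show "((\<lambda>t. energy_L \<rho> (f\<^sub>L t)) \<longlongrightarrow> w\<^sub>d\<^sup>2) at_top"
      by (subst tendsto_cong[where g = "\<lambda>t. Y t / \<rho> + 2 * w\<^sub>d * (y t / \<rho>) + w\<^sub>d\<^sup>2"])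
        (auto intro!: eventually_at_top_linorderI[of 0] simp: energy_L)
    show "((\<lambda>t. LINT w|f\<^sub>F t. (w - w\<^sub>d)\<^sup>2) \<longlongrightarrow> 0) at_top" using X0 by (simp add: X)
    show "((\<lambda>t. 1 / \<rho> * (LINT w|f\<^sub>L t. (w - w\<^sub>d)\<^sup>2)) \<longlongrightarrow> 0) at_top" using Y0' by (simp add: Y)
    show "weakly_tends_to f\<^sub>F (dirac w\<^sub>d)"
      using weakly_tends_to_dirac[OF F _ wd X0[unfolded X_def]] by simp
    show "weakly_tends_to f\<^sub>L (scale_measure (ennreal \<rho>) (dirac w\<^sub>d))"
      using weakly_tends_to_dirac[OF L \<rho>' wd Y0[unfolded Y_def]] by simp
    assume st: "steady_state f\<^sub>F \<and> steady_state f\<^sub>L"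
    have const: "X t = X 0" "Y t = Y 0" if "t \<ge> 0" for t
      using st that unfolding steady_state_def X_def Y_def by metis+
    have "(X \<longlongrightarrow> X 0) at_top" "(Y \<longlongrightarrow> Y 0) at_top"
      by (rule tendsto_eventually, rule eventually_at_top_linorderI[of 0], erule const)+
    then have "X 0 = 0" "Y 0 = 0"
      using X0 Y0 tendsto_unique[OF trivial_limit_at_top_linorder] by blast+
    then have "AE w in f\<^sub>F 0. w = w\<^sub>d" "AE w in f\<^sub>L 0. w = w\<^sub>d"
      using concentrated_at_centre[OF F[OF order_refl] zero_le_one]
        concentrated_at_centre[OF L[OF order_refl] \<rho>'] by (simp_all add: X_def Y_def)
    then show "f\<^sub>F 0 = dirac w\<^sub>d" "f\<^sub>L 0 = scale_measure (ennreal \<rho>) (dirac w\<^sub>d)"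
      using dirac_eqI[OF F[OF order_refl] zero_le_one wd] dirac_eqI[OF L[OF order_refl] \<rho>' wd]
      by simp_all
  qed
  show ?thesis
    using variance_F variance_L means_converge consensus unfolding mean_F_lim mean_L_lim by blast
qed

end
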